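(* Consider the AMP (added-mass partitioned) scheme for the viscous model problem defined in the context, with parameters $\rho,\mu,\bar\rho,\bar c,\Delta t,\Delta y,k_x>0$, and set $\lambda_x=\bar c\,k_x\,\Delta t$ and $\lambda_y=\bar c\,\Delta t/\Delta y$. If $\lambda_x^2+\lambda_y^2\le 1$, then the AMP scheme is weakly stable, i.e. every non-trivial normal mode of the scheme has amplification factor satisfying $|A|\le 1$. Equivalently, weak stability holds under the time-step restriction $$\Delta t\le \frac{1}{\bar c}\left[\frac{1}{\Delta y^2}+k_x^2\right]^{-1/2}.$$ This condition is sufficient but not necessary for weak stability.
   Context: Notation: $\nu=\mu/\rho$, $\bar z=\bar\rho\,\bar c$, $z_f=\dfrac{\rho}{k_x\Delta t}+2\mu k_x$, $i=\sqrt{-1}$. All unknowns are complex-valued Fourier coefficients for a fixed tangential wave number $k_x$. The fluid unknowns $v_1^n(y),v_2^n(y),p^n(y)$ are functions of $y\ge 0$, bounded as $y\to\infty$. The solid unknowns $a_{1,j}^n,b_{1,j}^n,a_{2,j}^n,b_{2,j}^n,d_j^n$ are grid functions for $j=0,-1,-2,\dots$ (with additional ghost values $a_{m,1}^n$, $m=1,2$), bounded as $j\to-\infty$. Solid update, for $j\le 0$: $$a_{1,j}^{n+1}=a_{1,j}^n+\lambda_y(a_{1,j+1}^n-a_{1,j}^n)+i\lambda_x(d_j^{n+1}-b_{2,j}^{n+1}),$$ $$b_{1,j}^{n+1}=b_{1,j}^n-\lambda_y(b_{1,j}^n-b_{1,j-1}^n)+i\lambda_x(a_{2,j}^{n+1}-d_j^{n+1}),$$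 $$a_{2,j}^{n+1}=a_{2,j}^n+\lambda_y(a_{2,j+1}^n-a_{2,j}^n)+i\lambda_x b_{1,j}^{n+1},$$ $$b_{2,j}^{n+1}=b_{2,j}^n-\lambda_y(b_{2,j}^n-b_{2,j-1}^n)-i\lambda_x a_{1,j}^{n+1},\qquad d_j^{n+1}=d_j^n.$$ The solid interface velocity and stress are $\bar v_{m,0}^{n}=\frac{1}{2\bar z}(a_{m,0}^n-b_{m,0}^n)$ and $\bar\sigma_{m2,0}^n=\frac12(a_{m,0}^n+b_{m,0}^n)$, $m=1,2$. Fluid update, for $y>0$: $$v_1^{n+1}=v_1^n-\frac{ik_x\Delta t}{\rho}p^n+\nu\Delta t(-k_x^2+\partial_y^2)v_1^{n+1},$$ $$v_2^{n+1}=v_2^n-\frac{\Delta t}{\rho}\partial_yp^n+\nu\Delta t(-k_x^2+\partial_y^2)v_2^{n+1},\qquad (-k_x^2+\partial_y^2)p^{n+1}=0,$$ with the following AMP interface conditions at $y=0$: $$\mu(ik_xv_2^{n+1}+\partial_yv_1^{n+1})-\bar z v_1^{n+1}=\bar\sigma_{12,0}^{n+1}-\bar z\,\bar v_{1,0}^{n+1},$$ $$v_2^{n+1}=\frac{z_f}{z_f+\bar z}\Big[v_2^n-\frac{\Delta t}{\rho}\partial_yp^n-\nu\Delta t\big(k_x^2v_2^{n+1}+ik_x\partial_yv_1^{n+1}\big)\Big]+\frac{\bar z}{z_f+\bar z}\bar v_{2,0}^{n+1},$$ $$-p^{n+1}+\frac{\bar z\Delta t}{\rho}\partial_yp^{n+1}=\bar\sigma_{22,0}^{n+1}+2ik_x\mu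 v_1^{n+1}-\bar z\Delta t\Big[\frac{\bar v_{2,0}^{n+1}-\bar v_{2,0}^n}{\Delta t}+\nu\big(k_x^2v_2^{n+1}+ik_x\partial_yv_1^{n+1}\big)\Big].$$ Interface projection: with all fluid quantities evaluated at $y=0$, set $v_{m,f}^{n+1}=v_m^{n+1}$, $\sigma_{12,f}^{n+1}=\mu(\partial_yv_1^{n+1}+ik_xv_2^{n+1})$, $\sigma_{22,f}^{n+1}=-p^{n+1}+2\mu\partial_yv_2^{n+1}$, and for $m=1,2$ $$v_m^I=\frac{z_f}{z_f+\bar z}v_{m,f}^{n+1}+\frac{\bar z}{z_f+\bar z}\bar v_{m,0}^{n+1}+\frac{1}{z_f+\bar z}(\bar\sigma_{m2,0}^{n+1}-\sigma_{m2,f}^{n+1}),$$ $$\sigma_{m2}^I=\frac{z_f^{-1}}{z_f^{-1}+\bar z^{-1}}\sigma_{m2,f}^{n+1}+\frac{\bar z^{-1}}{z_f^{-1}+\bar z^{-1}}\bar\sigma_{m2,0}^{n+1}+\frac{1}{z_f^{-1}+\bar z^{-1}}(\bar v_{m,0}^{n+1}-v_{m,f}^{n+1}).$$ The ghost values of the incoming solid characteristics are then set by $a_{m,1}^{n+1}=\sigma_{m2}^I+\bar z v_m^I$, $m=1,2$. A normal mode with amplification factor $A\in\mathbb{C}$ is a solution (for all $n$) of the system consisting of the five solid update equations for $a_{1,j}^n,b_{1,j}^n,a_{2,j}^n,b_{2,j}^n,d_j^n$ ($j\le 0$), the three fluid update equations for $v_1^n,v_2^n,p^n$ ($y>0$),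 the three AMP interface conditions at $y=0$, and the ghost-value conditions $a_{m,1}^{n+1}=\sigma_{m2}^I+\bar z v_m^I$, $m=1,2$, with $v_m^I$ and $\sigma_{m2}^I$ given by the interface projection formulas, in which every fluid and solid unknown at time level $n$ equals $A^n$ times an $n$-independent function of $y$ (fluid) or of $j$ (solid), with the stated boundedness as $y\to\infty$ and $j\to-\infty$; it is non-trivial if it is not identically zero. The scheme is weakly stable if there is no non-trivial normal mode with $|A|>1$. *)

theory Defs
  imports "HOL-Analysis.Analysis"
begin

text \<open>
  The coefficients of all unknowns at one time level. Fluid unknowns are meaningful for
  \<open>y \<ge> 0\<close>, solid unknowns for \<open>j \<le> 0\<close>, and the ghost values are \<open>a1 s 1\<close>, \<open>a2 s 1\<close>;
  values elsewhere are irrelevant and never constrained.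
\<close>

record amp_state =
  v1 :: "real \<Rightarrow> complex"
  v2 :: "real \<Rightarrow> complex"
  p  :: "real \<Rightarrow> complex"
  a1 :: "int \<Rightarrow> complex"
  b1 :: "int \<Rightarrow> complex"
  a2 :: "int \<Rightarrow> complex"
  b2 :: "int \<Rightarrow> complex"
  d  :: "int \<Rightarrow> complex"

text \<open>The derivative on the closed half line: one-sided at \<open>y = 0\<close>, two-sided for \<open>y > 0\<close>.\<close>

definition D\<^sub>y :: "(real \<Rightarrow> complex) \<Rightarrow> real \<Rightarrow> complex" where
  "D\<^sub>y f y = vector_derivative f (at y within {0..})"

definition regular :: "(real \<Rightarrow> complex) \<Rightarrow> bool" where
  "regular f \<longleftrightarrow> f differentiable_on {0..} \<and> D\<^sub>y f differentiable_on {0<..}"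

definition admissible :: "amp_state \<Rightarrow> bool" where
  "admissible s \<longleftrightarrow>
     regular (v1 s) \<and> regular (v2 s) \<and> regular (p s) \<and>
     Bfun (v1 s) at_top \<and> Bfun (v2 s) at_top \<and> Bfun (p s) at_top \<and>
     Bfun (a1 s) at_bot \<and> Bfun (b1 s) at_bot \<and> Bfun (a2 s) at_bot \<and> Bfun (b2 s) at_bot \<and>
     Bfun (d s) at_bot"

definition agree_scaled :: "complex \<Rightarrow> amp_state \<Rightarrow> amp_state \<Rightarrow> bool" where
  "agree_scaled c s s' \<longleftrightarrow>
     (\<forall>y\<ge>0. v1 s' y = c * v1 s y \<and> v2 s' y = c * v2 s y \<and> p s' y = c * p s y) \<and>
     (\<forall>j\<le>0. b1 s' j = c * b1 s j \<and> b2 s' j = c * b2 s j \<and> d s' j = c * d s j) \<and>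
     (\<forall>j\<le>1. a1 s' j = c * a1 s j \<and> a2 s' j = c * a2 s j)"

definition vanishes :: "amp_state \<Rightarrow> bool" where
  "vanishes s \<longleftrightarrow>
     (\<forall>y\<ge>0. v1 s y = 0 \<and> v2 s y = 0 \<and> p s y = 0) \<and>
     (\<forall>j\<le>0. b1 s j = 0 \<and> b2 s j = 0 \<and> d s j = 0) \<and>
     (\<forall>j\<le>1. a1 s j = 0 \<and> a2 s j = 0)"

definition lambda\<^sub>x :: "real \<Rightarrow> real \<Rightarrow> real \<Rightarrow> real" where
  "lambda\<^sub>x cbar \<Delta>t k\<^sub>x = cbar * k\<^sub>x * \<Delta>t"

definition lambda\<^sub>y :: "real \<Rightarrow> real \<Rightarrow> real \<Rightarrow> real" where
  "lambda\<^sub>y cbar \<Delta>t \<Delta>y = cbar * \<Delta>t / \<Delta>y"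

locale amp_scheme =
  fixes \<rho> \<mu> rhobar cbar \<Delta>t \<Delta>y k\<^sub>x :: real
begin

definition \<nu> :: real where "\<nu> = \<mu> / \<rho>"
definition zbar :: real where "zbar = rhobar * cbar"
definition z\<^sub>f :: real where "z\<^sub>f = \<rho> / (k\<^sub>x * \<Delta>t) + 2 * \<mu> * k\<^sub>x"

abbreviation L\<^sub>x :: complex where "L\<^sub>x \<equiv> complex_of_real (lambda\<^sub>x cbar \<Delta>t k\<^sub>x)"
abbreviation L\<^sub>y :: complex where "L\<^sub>y \<equiv> complex_of_real (lambda\<^sub>y cbar \<Delta>t \<Delta>y)"

definition solid_step :: "amp_state \<Rightarrow> amp_state \<Rightarrow> bool" where
  "solid_step s s' \<longleftrightarrow> (\<forall>j\<le>0.
     a1 s' j = a1 s j + L\<^sub>y * (a1 s (j + 1) - a1 s j) + \<i> * L\<^sub>x * (d s' j - b2 s' j) \<and>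
     b1 s' j = b1 s j - L\<^sub>y * (b1 s j - b1 s (j - 1)) + \<i> * L\<^sub>x * (a2 s' j - d s' j) \<and>
     a2 s' j = a2 s j + L\<^sub>y * (a2 s (j + 1) - a2 s j) + \<i> * L\<^sub>x * b1 s' j \<and>
     b2 s' j = b2 s j - L\<^sub>y * (b2 s j - b2 s (j - 1)) - \<i> * L\<^sub>x * a1 s' j \<and>
     d s' j = d s j)"

definition vbar1 :: "amp_state \<Rightarrow> complex" where "vbar1 s = (a1 s 0 - b1 s 0) / (2 * zbar)"
definition vbar2 :: "amp_state \<Rightarrow> complex" where "vbar2 s = (a2 s 0 - b2 s 0) / (2 * zbar)"
definition sigmabar12 :: "amp_state \<Rightarrow> complex" where "sigmabar12 s = (a1 s 0 + b1 s 0) / 2"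
definition sigmabar22 :: "amp_state \<Rightarrow> complex" where "sigmabar22 s = (a2 s 0 + b2 s 0) / 2"

definition fluid_step :: "amp_state \<Rightarrow> amp_state \<Rightarrow> bool" where
  "fluid_step s s' \<longleftrightarrow> (\<forall>y>0.
     v1 s' y = v1 s y - \<i> * k\<^sub>x * \<Delta>t / \<rho> * p s y
                + \<nu> * \<Delta>t * (- (k\<^sub>x\<^sup>2 * v1 s' y) + D\<^sub>y (D\<^sub>y (v1 s')) y) \<and>
     v2 s' y = v2 s y - \<Delta>t / \<rho> * D\<^sub>y (p s) y
                + \<nu> * \<Delta>t * (- (k\<^sub>x\<^sup>2 * v2 s' y) + D\<^sub>y (D\<^sub>y (v2 s')) y) \<and>
     - (k\<^sub>x\<^sup>2 * p s' y) + D\<^sub>y (D\<^sub>y (p s')) y = 0)"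

definition interface_tangential :: "amp_state \<Rightarrow> bool" where
  "interface_tangential s' \<longleftrightarrow>
     \<mu> * (\<i> * k\<^sub>x * v2 s' 0 + D\<^sub>y (v1 s') 0) - zbar * v1 s' 0
       = sigmabar12 s' - zbar * vbar1 s'"

definition interface_normal :: "amp_state \<Rightarrow> amp_state \<Rightarrow> bool" where
  "interface_normal s s' \<longleftrightarrow>
     v2 s' 0 = z\<^sub>f / (z\<^sub>f + zbar) *
                 (v2 s 0 - \<Delta>t / \<rho> * D\<^sub>y (p s) 0
                   - \<nu> * \<Delta>t * (k\<^sub>x\<^sup>2 * v2 s' 0 + \<i> * k\<^sub>x * D\<^sub>y (v1 s') 0))
               + zbar / (z\<^sub>f + zbar) * vbar2 s'"

definition interface_pressure :: "amp_state \<Rightarrow> amp_state \<Rightarrow> bool" where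
  "interface_pressure s s' \<longleftrightarrow>
     - p s' 0 + zbar * \<Delta>t / \<rho> * D\<^sub>y (p s') 0
       = sigmabar22 s' + 2 * \<i> * k\<^sub>x * \<mu> * v1 s' 0
         - zbar * \<Delta>t * ((vbar2 s' - vbar2 s) / \<Delta>t
             + \<nu> * (k\<^sub>x\<^sup>2 * v2 s' 0 + \<i> * k\<^sub>x * D\<^sub>y (v1 s') 0))"

definition sigma12f :: "amp_state \<Rightarrow> complex" where
  "sigma12f s = \<mu> * (D\<^sub>y (v1 s) 0 + \<i> * k\<^sub>x * v2 s 0)"
definition sigma22f :: "amp_state \<Rightarrow> complex" where
  "sigma22f s = - p s 0 + 2 * \<mu> * D\<^sub>y (v2 s) 0"

text \<open>
  Interface projection of one component; the arguments are the fluid velocity and stress,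
  then the solid velocity and stress, at the interface.
\<close>

definition projected_velocity :: "complex \<Rightarrow> complex \<Rightarrow> complex \<Rightarrow> complex \<Rightarrow> complex" where
  "projected_velocity vf sf vs ss =
     z\<^sub>f / (z\<^sub>f + zbar) * vf + zbar / (z\<^sub>f + zbar) * vs + 1 / (z\<^sub>f + zbar) * (ss - sf)"
  for vf sf vs ss :: complex

definition projected_stress :: "complex \<Rightarrow> complex \<Rightarrow> complex \<Rightarrow> complex \<Rightarrow> complex" where
  "projected_stress vf sf vs ss =
     inverse z\<^sub>f / (inverse z\<^sub>f + inverse zbar) * sf
     + inverse zbar / (inverse z\<^sub>f + inverse zbar) * ss
     + 1 / (inverse z\<^sub>f + inverse zbar) * (vs - vf)"
  for vf sf vs ss :: complex

definition ghost_values :: "amp_state \<Rightarrow> bool" where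
  "ghost_values s \<longleftrightarrow>
     a1 s 1 = projected_stress (v1 s 0) (sigma12f s) (vbar1 s) (sigmabar12 s)
              + zbar * projected_velocity (v1 s 0) (sigma12f s) (vbar1 s) (sigmabar12 s) \<and>
     a2 s 1 = projected_stress (v2 s 0) (sigma22f s) (vbar2 s) (sigmabar22 s)
              + zbar * projected_velocity (v2 s 0) (sigma22f s) (vbar2 s) (sigmabar22 s)"

definition amp_solution :: "(nat \<Rightarrow> amp_state) \<Rightarrow> bool" where
  "amp_solution U \<longleftrightarrow> (\<forall>n. admissible (U n)) \<and>
     (\<forall>n. solid_step (U n) (U (Suc n)) \<and>
          fluid_step (U n) (U (Suc n)) \<and>
          interface_tangential (U (Suc n)) \<and>
          interface_normal (U n) (U (Suc n)) \<and>
          interface_pressure (U n) (U (Suc n)) \<and>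
          ghost_values (U (Suc n)))"

definition normal_mode :: "complex \<Rightarrow> (nat \<Rightarrow> amp_state) \<Rightarrow> bool" where
  "normal_mode A U \<longleftrightarrow> amp_solution U \<and> (\<exists>s. \<forall>n. agree_scaled (A ^ n) s (U n))"

definition nontrivial :: "(nat \<Rightarrow> amp_state) \<Rightarrow> bool" where
  "nontrivial U \<longleftrightarrow> \<not> (\<forall>n. vanishes (U n))"

definition weakly_stable :: bool where
  "weakly_stable \<longleftrightarrow> \<not> (\<exists>A U. normal_mode A U \<and> nontrivial U \<and> norm A > 1)"

end

end

theory Submission
  imports Defs
begin

text \<open>
  Let \<open>A\<close> be the amplification factor of a normal mode with \<open>|A| > 1\<close>; the claim is that every
  component of the mode vanishes. The solid can be treated before the fluid. In the projected
  interface values, the fluid contributions to the incoming characteristic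
  \<open>\<sigma>\<^sup>I + zbar v\<^sup>I\<close> cancel, so the ghost conditions say that \<open>a\<^sub>m\<close> is extrapolated by a
  constant, \<open>a\<^sub>m(1) = a\<^sub>m(0)\<close> (\<open>projection_is_extrapolation\<close>).

  Since \<open>d\<close> does not change in time, \<open>d = 0\<close>, and the solid falls apart into two copies of one
  system for a pair of characteristics \<open>(a, b)\<close>. Eliminating \<open>b\<close> leaves a three-term recurrence
  for \<open>a\<close> whose characteristic roots are \<open>\<kappa>\<close> and \<open>1/\<kappa>\<close>. A root on the unit circle would be a
  Fourier mode of the scheme on the whole line, and these do not grow if \<open>\<lambda>\<^sub>y \<le> 1\<close>
  (\<open>characteristic_root_off_spectrum\<close>); hence \<open>|\<kappa>| > 1\<close> for one root. Boundedness as
  \<open>j \<rightarrow> -\<infinity>\<close> selects \<open>a(j) = a(0) \<kappa>\<^sup>j\<close>, and \<open>a(1) = a(0)\<close> then forces \<open>a = 0\<close>, so also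
  \<open>b = 0\<close> (\<open>solid_mode_trivial\<close>).

  With a vanishing solid, the bounded solutions in the fluid are combinations of
  \<open>exp (-k\<^sub>x y)\<close> and \<open>exp (-\<gamma> y)\<close>, where \<open>\<gamma>\<^sup>2 = k\<^sub>x\<^sup>2 + (1 - 1/A) / (\<nu> \<Delta>t)\<close>
  (\<open>bounded_forced_solution\<close>). Three amplitudes remain, and the three AMP interface conditions
  are a homogeneous linear system for them. Its determinant is a nonzero multiple of a cubic in
  the scaled impedance \<open>Z = zbar k\<^sub>x \<Delta>t / \<rho> > 0\<close>; after division by \<open>\<gamma>\<close>, every
  coefficient of the cubic has positive real part, because \<open>|1/A| < 1\<close> gives
  \<open>Re (\<gamma>\<^sup>2) > k\<^sub>x\<^sup>2\<close> (\<open>interface_symbol_nonzero\<close>). So the fluid vanishes as well.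

  The Courant-Friedrichs-Lewy bound \<open>\<lambda>\<^sub>x\<^sup>2 + \<lambda>\<^sub>y\<^sup>2 \<le> 1\<close> enters through its consequence
  \<open>\<lambda>\<^sub>y \<le> 1\<close>. That it is not necessary is witnessed by \<open>\<lambda>\<^sub>x = \<lambda>\<^sub>y = 1\<close>.
\<close>

section \<open>The solid difference scheme on a half line\<close>

text \<open>
  The spatial root \<open>\<kappa>\<close> of a mode enters its dispersion relation only through \<open>\<kappa> + 1/\<kappa>\<close>, which
  is \<open>2 c = 2 cos \<theta>\<close> for a Fourier mode \<open>\<kappa> = exp (\<i> \<theta>)\<close>. As a polynomial in \<open>A\<close> this relation is
  the real quadratic \<open>(1 + m\<^sup>2) A\<^sup>2 - 2 r A + R\<close>, where \<open>r\<close> and \<open>R\<close> are the real part and the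
  squared modulus of the upwind symbol \<open>1 - l + l exp (\<i> \<theta>)\<close>. For \<open>l \<le> 1\<close> that symbol
  lies in the unit disc, so \<open>r\<^sup>2 \<le> R \<le> 1\<close>; the discriminant is not positive and both
  roots have squared modulus \<open>R / (1 + m\<^sup>2)\<close>.
\<close>

lemma characteristic_root_off_spectrum:
  fixes A :: complex and l m c :: real
  assumes l: "0 \<le> l" "l \<le> 1" and m: "m \<noteq> 0" and c: "\<bar>c\<bar> \<le> 1" and A: "norm A > 1"
  shows "(A - 1 + l)\<^sup>2 + l\<^sup>2 + m\<^sup>2 * A\<^sup>2 \<noteq> 2 * c * (l * (A - 1 + l))"
proof
  assume eq: "(A - 1 + l)\<^sup>2 + l\<^sup>2 + m\<^sup>2 * A\<^sup>2 = 2 * c * (l * (A - 1 + l))"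
  define r where "r = 1 - l + l * c"
  define R where "R = (1 - l)\<^sup>2 + 2 * l * (1 - l) * c + l\<^sup>2"
  obtain x y where xy: "A = Complex x y" by (cases A)
  have nrm: "x\<^sup>2 + y\<^sup>2 > 1"
    using A by (simp add: xy cmod_def)
  have re: "(1 + m\<^sup>2) * (x\<^sup>2 - y\<^sup>2) - 2 * x * r + R = 0"
    using arg_cong[OF eq, of Re] unfolding xy r_def R_def
    by (simp add: power2_eq_square algebra_simps)
  have im: "y * ((1 + m\<^sup>2) * x - r) = 0"
    using arg_cong[OF eq, of Im] unfolding xy r_def R_def
    by (simp add: power2_eq_square algebra_simps)
  have "R = 1 - 2 * l * (1 - l) * (1 - c)"
    by (simp add: R_def power2_eq_square algebra_simps)
  then have R1: "R \<le> 1"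
    using l c by simp
  have "R - r\<^sup>2 = l\<^sup>2 * (1 - c\<^sup>2)"
    by (simp add: R_def r_def power2_eq_square algebra_simps)
  moreover have "c\<^sup>2 \<le> 1"
    using c by (simp add: abs_square_le_1)
  ultimately have rR: "r\<^sup>2 \<le> R"
    by (smt (verit) zero_le_mult_iff zero_le_power2)
  show False
  proof (cases "y = 0")
    case True
    have "m\<^sup>2 * x\<^sup>2 + (x - r)\<^sup>2 + (R - r\<^sup>2) = 0"
      using re True by (simp add: power2_eq_square algebra_simps)
    moreover have "m\<^sup>2 * x\<^sup>2 > 0"
      using m nrm True by (intro mult_pos_pos) auto
    ultimately show False
      using rR by (smt (verit) zero_le_power2)
  next
    case False
    then have r: "r = (1 + m\<^sup>2) * x" using im by simp
    have "(1 + m\<^sup>2) * (x\<^sup>2 + y\<^sup>2) = R"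
      using re unfolding r by (simp add: power2_eq_square algebra_simps)
    moreover have "1 * (x\<^sup>2 + y\<^sup>2) \<le> (1 + m\<^sup>2) * (x\<^sup>2 + y\<^sup>2)"
      by (rule mult_right_mono) auto
    ultimately have "x\<^sup>2 + y\<^sup>2 \<le> R" by simp
    with nrm R1 show False by linarith
  qed
qed

lemma exists_large_reciprocal_root:
  fixes T :: complex
  assumes "\<And>c::real. \<bar>c\<bar> \<le> 1 \<Longrightarrow> T \<noteq> complex_of_real (2 * c)"
  shows "\<exists>\<kappa>. norm \<kappa> > 1 \<and> T = \<kappa> + 1 / \<kappa>"
proof -
  define \<kappa> where "\<kappa> = (T + csqrt (T\<^sup>2 - 4)) / 2"
  have "(2 * \<kappa> - T)\<^sup>2 = T\<^sup>2 - 4"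
  proof -
    have "2 * \<kappa> - T = csqrt (T\<^sup>2 - 4)" by (simp add: \<kappa>_def field_simps)
    then show ?thesis by simp
  qed
  then have eq: "\<kappa> * (T - \<kappa>) = 1"
    by algebra
  then have nz: "\<kappa> \<noteq> 0" by auto
  then have T: "T = \<kappa> + 1 / \<kappa>"
    using eq by (simp add: field_simps)
  have "norm \<kappa> \<noteq> 1"
  proof
    assume n: "norm \<kappa> = 1"
    have "1 / \<kappa> = cnj \<kappa>"
    proof -
      have "\<kappa> * cnj \<kappa> = 1"
        using complex_norm_square[of \<kappa>] n by simp
      then show ?thesis using nz by (metis nonzero_mult_div_cancel_left)
    qed
    then have "T = complex_of_real (2 * Re \<kappa>)"
      by (simp add: T complex_eq_iff)
    moreover have "\<bar>Re \<kappa>\<bar> \<le> 1"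
      using abs_Re_le_cmod[of \<kappa>] n by simp
    ultimately show False using assms by blast
  qed
  then consider "norm \<kappa> > 1" | "norm \<kappa> < 1" by linarith
  then show ?thesis
  proof cases
    case 1 then show ?thesis using T by blast
  next
    case 2
    then have "norm (1 / \<kappa>) > 1" using nz by (simp add: norm_divide field_simps)
    moreover have "T = 1 / \<kappa> + 1 / (1 / \<kappa>)" using T by simp
    ultimately show ?thesis by blast
  qed
qed

text \<open>
  The combination \<open>x (Suc n) - x n / \<kappa>\<close> isolates the growing mode: it is multiplied by \<open>\<kappa>\<close> at
  every step, so a bounded sequence does not contain it.
\<close>

lemma bounded_recurrence_decays:
  fixes x :: "nat \<Rightarrow> complex"
  assumes rec: "\<And>n. x (Suc (Suc n)) + x n = (\<kappa> + 1 / \<kappa>) * x (Suc n)"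
    and bdd: "Bseq x" and \<kappa>: "norm \<kappa> > 1"
  shows "x (Suc n) = x n / \<kappa>"
proof -
  define e where "e n = x (Suc n) - x n / \<kappa>" for n
  have nz: "\<kappa> \<noteq> 0" using \<kappa> by auto
  have step: "e (Suc n) = \<kappa> * e n" for n
    using rec[of n] nz by (simp add: e_def algebra_simps)
  have pow: "e n = \<kappa> ^ n * e 0" for n
    by (induction n) (auto simp: step)
  obtain K where K: "\<And>n. norm (x n) \<le> K"
    using bdd by (auto simp: Bseq_def)
  have e_le: "norm (e n) \<le> K + K" for n
  proof -
    have "norm (x n / \<kappa>) \<le> norm (x n)"
      using \<kappa> by (simp add: norm_divide divide_le_eq mult_le_cancel_left1)
    then show ?thesis
      unfolding e_def using K[of n] K[of "Suc n"] norm_triangle_ineq4[of "x (Suc n)" "x n / \<kappa>"]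
      by linarith
  qed
  have "e 0 = 0"
  proof (rule ccontr)
    assume e0: "e 0 \<noteq> 0"
    obtain n where "(K + K) / norm (e 0) < norm \<kappa> ^ n"
      using real_arch_pow[OF \<kappa>] by blast
    then have "K + K < norm (e n)"
      using e0 by (subst pow) (simp add: norm_mult norm_power field_simps)
    with e_le[of n] show False by linarith
  qed
  then have "e n = 0" by (simp add: pow[of n])
  then show ?thesis by (simp add: e_def)
qed

text \<open>
  The modes of one pair of characteristics: \<open>a\<close> enters the solid at the interface, \<open>b\<close> leaves it.
  Constant extrapolation of \<open>a\<close> is incompatible with a decay factor \<open>1/\<kappa> \<noteq> 1\<close>.
\<close>

lemma solid_mode_trivial:
  fixes a b :: "int \<Rightarrow> complex" and l m :: real and A :: complex
  assumes l: "0 < l" "l \<le> 1" and m: "m \<noteq> 0" and A: "norm A > 1"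
    and a_eq: "\<And>j. j \<le> 0 \<Longrightarrow> A * a j = a j + l * (a (j + 1) - a j) - \<i> * m * (A * b j)"
    and b_eq: "\<And>j. j \<le> 0 \<Longrightarrow> A * b j = b j - l * (b j - b (j - 1)) - \<i> * m * (A * a j)"
    and bdd: "Bfun a at_bot" and ghost: "a 1 = a 0"
  shows "(\<forall>j\<le>1. a j = 0) \<and> (\<forall>j\<le>0. b j = 0)"
proof -
  define B where "B = A - 1 + l"
  have B0: "B \<noteq> 0"
  proof
    assume "B = 0"
    then have "A = complex_of_real (1 - l)" by (simp add: B_def algebra_simps)
    then have "norm A = \<bar>1 - l\<bar>" by (simp only: norm_of_real)
    with A l show False by simp
  qed
  have A0: "A \<noteq> 0" using A by auto
  have b_of_a: "\<i> * m * A * b j = l * a (j + 1) - B * a j" if "j \<le> 0" for j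
    using a_eq[OF that] by (simp add: B_def algebra_simps)
  \<comment> \<open>Elimination of \<open>b\<close> from the two equations, using the first one at \<open>j\<close> and at \<open>j - 1\<close>.\<close>
  have three_term: "l * B * (a (j + 1) + a (j - 1)) = (B\<^sup>2 + l\<^sup>2 + m\<^sup>2 * A\<^sup>2) * a j"
    if j: "j \<le> 0" for j
  proof -
    have "B * b j - l * b (j - 1) = - (\<i> * m * A * a j)"
      using b_eq[OF j] by (simp add: B_def algebra_simps)
    then have "B * (\<i> * m * A * b j) - l * (\<i> * m * A * b (j - 1)) = - (\<i> * m * A)\<^sup>2 * a j"
      by algebra
    then have "B * (l * a (j + 1) - B * a j) - l * (l * a j - B * a (j - 1)) = (m * A)\<^sup>2 * a j"
      using b_of_a[OF j] b_of_a[of "j - 1"] j by (simp add: power_mult_distrib)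
    then show ?thesis
      by (simp add: power_mult_distrib algebra_simps power2_eq_square)
  qed
  define T where "T = (B\<^sup>2 + l\<^sup>2 + m\<^sup>2 * A\<^sup>2) / (l * B)"
  have T_eq: "T * (l * B) = B\<^sup>2 + l\<^sup>2 + m\<^sup>2 * A\<^sup>2"
    using B0 l by (simp add: T_def)
  have "T \<noteq> complex_of_real (2 * c)" if "\<bar>c\<bar> \<le> 1" for c :: real
  proof
    assume "T = complex_of_real (2 * c)"
    then have "B\<^sup>2 + l\<^sup>2 + m\<^sup>2 * A\<^sup>2 = 2 * c * (l * B)"
      using T_eq by simp
    then show False
      using characteristic_root_off_spectrum[of l m c A] l m A that by (simp add: B_def)
  qed
  then obtain \<kappa> where \<kappa>: "norm \<kappa> > 1" and T: "T = \<kappa> + 1 / \<kappa>"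
    using exists_large_reciprocal_root by blast
  \<comment> \<open>The index is reversed and shifted so that \<open>x 0\<close> is the ghost value.\<close>
  define x where "x n = a (1 - int n)" for n
  have rec: "x (Suc (Suc n)) + x n = (\<kappa> + 1 / \<kappa>) * x (Suc n)" for n
  proof -
    have "(l * B) * (a (- int n + 1) + a (- int n - 1)) = (l * B) * (T * a (- int n))"
      using three_term[of "- int n"] T_eq by (simp add: mult.assoc[symmetric] mult.commute[of _ T])
    then have "a (- int n + 1) + a (- int n - 1) = T * a (- int n)"
      using B0 l by simp
    moreover have "1 - int (Suc (Suc n)) = - int n - 1" "1 - int (Suc n) = - int n"
      "1 - int n = - int n + 1"
      by simp_all
    ultimately show ?thesis
      unfolding T[symmetric] x_def by (simp only: add.commute)
  qed
  have bdd_x: "Bseq x"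
  proof -
    obtain K where "K > 0" and K: "eventually (\<lambda>j. norm (a j) \<le> K) at_bot"
      using bdd unfolding Bfun_def by blast
    have "filterlim (\<lambda>n. 1 - int n) at_bot sequentially"
      unfolding filterlim_at_bot eventually_sequentially
    proof
      fix Z :: int
      show "\<exists>N. \<forall>n\<ge>N. 1 - int n \<le> Z" by (rule exI[of _ "nat (1 - Z)"]) auto
    qed
    from eventually_compose_filterlim[OF K this] show ?thesis
      unfolding x_def by (rule BfunI)
  qed
  have decay: "x (Suc n) = x n / \<kappa>" for n
    by (rule bounded_recurrence_decays[OF rec bdd_x \<kappa>])
  have "x 1 = x 0" by (simp add: x_def ghost)
  then have "x 0 * \<kappa> = x 0"
    using decay[of 0] \<kappa> by (metis One_nat_def less_asym nonzero_mult_div_cancel_right norm_zero times_divide_eq_left zero_less_one)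
  then have "x 0 * (\<kappa> - 1) = 0" by (simp add: algebra_simps)
  moreover have "\<kappa> \<noteq> 1" using \<kappa> by auto
  ultimately have "x 0 = 0" by simp
  then have xz: "x n = 0" for n
    by (induction n) (auto simp: decay)
  have az: "a j = 0" if "j \<le> 1" for j
    using xz[of "nat (1 - j)"] that by (simp add: x_def)
  moreover have "b j = 0" if "j \<le> 0" for j
    using b_of_a[OF that] az[of j] az[of "j + 1"] that m A0 by simp
  ultimately show ?thesis by blast
qed

section \<open>Bounded solutions on the half line\<close>

lemma exp_has_vector_derivative:
  "((\<lambda>y. exp (c * complex_of_real y)) has_vector_derivative c * exp (c * y)) (at y within S)"
proof -
  have "((\<lambda>z. exp (c * z)) has_field_derivative c * exp (c * complex_of_real y)) (at (complex_of_real y))"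
    by (auto intro!: derivative_eq_intros)
  from has_vector_derivative_real_field[OF this] show ?thesis .
qed

text \<open>
  The second-order operator factors: \<open>g + \<gamma> f\<close> is a multiple of \<open>exp (\<gamma> y)\<close> and \<open>g - \<gamma> f\<close> one
  of \<open>exp (- \<gamma> y)\<close>. Boundedness of \<open>f\<close> removes the growing exponential. The equation holds only
  for \<open>y > 0\<close>; continuity extends the formula to \<open>y = 0\<close>.
\<close>

lemma bounded_solution_is_decaying_exponential:
  fixes f g :: "real \<Rightarrow> complex" and \<gamma> :: complex
  assumes f: "\<And>y. y > 0 \<Longrightarrow> (f has_vector_derivative g y) (at y)"
    and g: "\<And>y. y > 0 \<Longrightarrow> (g has_vector_derivative \<gamma>\<^sup>2 * f y) (at y)"
    and cont: "continuous_on {0..} f" and bdd: "Bfun f at_top" and \<gamma>: "Re \<gamma> > 0"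
    and y: "y \<ge> 0"
  shows "f y = f 0 * exp (- \<gamma> * y)"
proof -
  have \<gamma>0: "\<gamma> \<noteq> 0" using \<gamma> by auto
  have const_on: "\<exists>C. \<forall>y>0. h y = C" if "\<And>y. y > 0 \<Longrightarrow> (h has_vector_derivative 0) (at y)"
    for h :: "real \<Rightarrow> complex"
    using has_vector_derivative_zero_constant[of "{0<..}" h] that
    by (metis convex_real_interval(2,3) greaterThan_iff has_vector_derivative_at_within)
  have deriv_p: "((\<lambda>y. exp (- \<gamma> * complex_of_real y) * (g y + \<gamma> * f y)) has_vector_derivative 0) (at y)"
    if "y > 0" for y
    by (rule has_vector_derivative_eq_rhs, (rule derivative_intros exp_has_vector_derivative f g that)+)
       (simp add: power2_eq_square algebra_simps)
  then obtain C where C: "\<And>y. y > 0 \<Longrightarrow> exp (- \<gamma> * complex_of_real y) * (g y + \<gamma> * f y) = C"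
    using const_on[OF deriv_p] by auto
  have deriv_m: "((\<lambda>y. exp (\<gamma> * complex_of_real y) * (g y - \<gamma> * f y)) has_vector_derivative 0) (at y)"
    if "y > 0" for y
    by (rule has_vector_derivative_eq_rhs, (rule derivative_intros exp_has_vector_derivative f g that)+)
       (simp add: power2_eq_square algebra_simps)
  then obtain C' where C': "\<And>y. y > 0 \<Longrightarrow> exp (\<gamma> * complex_of_real y) * (g y - \<gamma> * f y) = C'"
    using const_on[OF deriv_m] by auto
  have f_eq: "2 * \<gamma> * f y = C * exp (\<gamma> * y) - C' * exp (- \<gamma> * y)" if "y > 0" for y
  proof -
    have "g y + \<gamma> * f y = C * exp (\<gamma> * y)" "g y - \<gamma> * f y = C' * exp (- \<gamma> * y)"
      using C[OF that] C'[OF that] by (auto simp: exp_minus field_simps)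
    then show ?thesis by algebra
  qed
  have "C = 0"
  proof (rule ccontr)
    assume C0: "C \<noteq> 0"
    obtain K where K: "eventually (\<lambda>y. norm (f y) \<le> K) at_top"
      using bdd unfolding Bfun_def by blast
    have bound: "eventually (\<lambda>y. norm C * exp (Re \<gamma> * y) \<le> 2 * norm \<gamma> * K + norm C') at_top"
      using K eventually_gt_at_top[of 0]
    proof eventually_elim
      case (elim y)
      have "C * exp (\<gamma> * y) = 2 * \<gamma> * f y + C' * exp (- \<gamma> * y)"
        using f_eq[of y] elim by simp
      then have "norm C * exp (Re \<gamma> * y) = norm (2 * \<gamma> * f y + C' * exp (- \<gamma> * y))"
        by (metis norm_mult norm_exp_eq_Re Re_complex_of_real times_complex.simps(1) Im_complex_of_real mult_zero_right diff_zero)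
      also have "\<dots> \<le> norm (2 * \<gamma> * f y) + norm (C' * exp (- \<gamma> * y))"
        by (rule norm_triangle_ineq)
      also have "\<dots> \<le> 2 * norm \<gamma> * K + norm C'"
      proof (rule add_mono)
        show "norm (2 * \<gamma> * f y) \<le> 2 * norm \<gamma> * K"
          using elim by (simp add: norm_mult mult_left_mono)
        show "norm (C' * exp (- \<gamma> * y)) \<le> norm C'"
          using \<gamma> elim by (simp add: norm_mult mult_left_le)
      qed
      finally show ?case .
    qed
    have "filterlim (\<lambda>y. norm C * exp (Re \<gamma> * y)) at_top at_top"
      using C0 \<gamma>
      by (intro filterlim_tendsto_pos_mult_at_top[OF tendsto_const]
          filterlim_compose[OF exp_at_top] filterlim_ident) auto
    then have "eventually (\<lambda>y. norm C * exp (Re \<gamma> * y) > 2 * norm \<gamma> * K + norm C') at_top"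
      by (simp add: filterlim_at_top_dense)
    with bound have "eventually (\<lambda>y::real. False) at_top"
      by eventually_elim auto
    then show False by simp
  qed
  define h where "h y = f y * exp (\<gamma> * complex_of_real y)" for y
  have "h y = - C' / (2 * \<gamma>)" if "y \<in> {0<..}" for y
    using f_eq[of y] that \<open>C = 0\<close> \<gamma>0 by (simp add: h_def exp_minus field_simps)
  moreover have "continuous_on (closure {0<..}) h"
    unfolding h_def by (auto intro!: continuous_intros cont)
  ultimately have const: "h y = - C' / (2 * \<gamma>)" if "y \<in> closure {0<..}" for y
    using continuous_constant_on_closure[of "{0<..}" h] that by blast
  have "h y = h 0" using const[of y] const[of 0] y by simp
  then show ?thesis by (simp add: h_def exp_minus field_simps)
qed

lemma regular_has_derivatives:
  assumes "regular f" "y > 0"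
  shows "(f has_vector_derivative D\<^sub>y f y) (at y)"
    and "(D\<^sub>y f has_vector_derivative D\<^sub>y (D\<^sub>y f) y) (at y)"
proof -
  have at: "at y within {0..} = at y" "at y within {0<..} = at y"
    using assms(2) by (auto intro: at_within_interior at_within_open)
  have "f differentiable (at y)" "D\<^sub>y f differentiable (at y)"
    using assms at unfolding regular_def differentiable_on_def
    by (metis atLeast_iff less_imp_le, metis greaterThan_iff)
  then show "(f has_vector_derivative D\<^sub>y f y) (at y)"
    "(D\<^sub>y f has_vector_derivative D\<^sub>y (D\<^sub>y f) y) (at y)"
    by (simp_all add: D\<^sub>y_def[of _ y] at vector_derivative_works)
qed

lemma regular_has_derivative_within:
  assumes "regular f" "y \<ge> 0"
  shows "(f has_vector_derivative D\<^sub>y f y) (at y within {0..})"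
  using assms by (simp add: regular_def differentiable_on_def D\<^sub>y_def vector_derivative_works)

lemma D_y_unique:
  assumes "(f has_vector_derivative c) (at y within {0..})" "y \<ge> 0"
  shows "D\<^sub>y f y = c"
proof -
  have "at y within {y<..} \<le> at y within {0..}"
    using assms(2) by (intro at_le) auto
  then have "at y within {0..} \<noteq> bot"
    by (metis bot.extremum_uniqueI trivial_limit_at_right_real)
  then show ?thesis
    unfolding D\<^sub>y_def using assms(1) by (rule vector_derivative_within)
qed

lemma D_y_scaled:
  assumes f: "regular f" and eq: "\<And>y. y \<ge> 0 \<Longrightarrow> g y = c * f y" and y: "y \<ge> 0"
  shows "D\<^sub>y g y = c * D\<^sub>y f y"
proof (rule D_y_unique)
  have "((\<lambda>y. c * f y) has_vector_derivative c * D\<^sub>y f y) (at y within {0..})"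
    by (intro derivative_intros regular_has_derivative_within f y)
  then show "(g has_vector_derivative c * D\<^sub>y f y) (at y within {0..})"
    by (rule has_vector_derivative_transform[rotated 2]) (auto simp: eq y)
qed (fact y)

lemma D_y_two_exponentials:
  assumes "\<And>y. y \<ge> 0 \<Longrightarrow> f y = a * exp (c * complex_of_real y) + a' * exp (c' * complex_of_real y)"
    and y: "y \<ge> 0"
  shows "D\<^sub>y f y = a * (c * exp (c * y)) + a' * (c' * exp (c' * y))"
proof (rule D_y_unique)
  have "((\<lambda>y. a * exp (c * complex_of_real y) + a' * exp (c' * complex_of_real y))
      has_vector_derivative a * (c * exp (c * y)) + a' * (c' * exp (c' * y))) (at y within {0..})"
    by (intro derivative_intros exp_has_vector_derivative)
  then show "(f has_vector_derivative a * (c * exp (c * y)) + a' * (c' * exp (c' * y))) (at y within {0..})"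
    by (rule has_vector_derivative_transform[rotated 2]) (auto simp: assms)
qed (fact y)

text \<open>
  The forcing is written with the factor \<open>\<gamma>\<^sup>2 - k\<^sup>2\<close> so that the particular solution is just
  \<open>- c exp (- k y)\<close>. This covers the pressure (\<open>c = 0\<close>, \<open>\<gamma> = k\<close>) and both velocity components,
  which are driven by a harmonic pressure.
\<close>

lemma bounded_forced_solution:
  fixes \<gamma> c :: complex and k :: real
  assumes reg: "regular f" and bdd: "Bfun f at_top" and \<gamma>: "Re \<gamma> > 0" and k: "k > 0"
    and ode: "\<And>y. y > 0 \<Longrightarrow>
      D\<^sub>y (D\<^sub>y f) y = \<gamma>\<^sup>2 * f y + (\<gamma>\<^sup>2 - k\<^sup>2) * c * exp (- k * complex_of_real y)"
    and y: "y \<ge> 0"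
  shows "f y = (f 0 + c) * exp (- \<gamma> * y) - c * exp (- k * complex_of_real y)"
proof -
  define e where "e y = exp (- k * complex_of_real y)" for y
  have e: "(e has_vector_derivative - k * e y) (at y within S)" for y S
    using exp_has_vector_derivative[of "- k" y S] by (simp add: e_def[abs_def])
  have "f y + c * e y = (f 0 + c * e 0) * exp (- \<gamma> * y)"
  proof (rule bounded_solution_is_decaying_exponential[where f = "\<lambda>y. f y + c * e y"])
    show "((\<lambda>y. f y + c * e y) has_vector_derivative D\<^sub>y f y + c * (- k * e y)) (at y)"
      if "y > 0" for y
      using that by (intro derivative_intros e regular_has_derivatives reg)
    show "((\<lambda>y. D\<^sub>y f y + c * (- k * e y)) has_vector_derivative \<gamma>\<^sup>2 * (f y + c * e y)) (at y)"
      if "y > 0" for y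
    proof (rule has_vector_derivative_eq_rhs)
      show "((\<lambda>y. D\<^sub>y f y + c * (- k * e y)) has_vector_derivative
          D\<^sub>y (D\<^sub>y f) y + c * (- k * (- k * e y))) (at y)"
        using that by (intro derivative_intros e regular_has_derivatives reg)
    qed (use ode[OF that] in \<open>simp add: e_def power2_eq_square algebra_simps\<close>)
    have "continuous_on {0..} f"
      using reg by (simp add: regular_def differentiable_imp_continuous_on)
    then show "continuous_on {0..} (\<lambda>y. f y + c * e y)"
      unfolding e_def by (intro continuous_intros)
    have "eventually (\<lambda>y. norm (c * e y) \<le> norm c) at_top"
      using eventually_ge_at_top[of 0]
      by eventually_elim (use k in \<open>simp add: e_def norm_mult mult_left_le\<close>)
    moreover obtain K where "eventually (\<lambda>y. norm (f y) \<le> K) at_top"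
      using bdd unfolding Bfun_def by blast
    ultimately have "eventually (\<lambda>y. norm (f y + c * e y) \<le> K + norm c) at_top"
      by eventually_elim (rule order.trans[OF norm_triangle_ineq add_mono])
    then show "Bfun (\<lambda>y. f y + c * e y) at_top" by (rule BfunI)
  qed (fact \<gamma> y)+
  then show ?thesis by (simp add: e_def algebra_simps)
qed

section \<open>The interface conditions as a linear system\<close>

lemma linear_system_3_trivial:
  fixes a b c x y z :: "'a :: idom"
  assumes "a * x + b * y + c * z = 0" "a' * x + b' * y + c' * z = 0"
    "a'' * x + b'' * y + c'' * z = 0"
    and "a * (b' * c'' - b'' * c') - b * (a' * c'' - a'' * c') + c * (a' * b'' - a'' * b') \<noteq> 0"
  shows "x = 0 \<and> y = 0 \<and> z = 0"
proof -
  let ?D = "a * (b' * c'' - b'' * c') - b * (a' * c'' - a'' * c') + c * (a' * b'' - a'' * b')"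
  have "?D * x = 0" "?D * y = 0" "?D * z = 0" using assms(1-3) by algebra+
  with assms(4) show ?thesis by simp
qed

text \<open>
  The expression is, up to a nonzero factor, the determinant of the interface conditions, with
  \<open>u = 1/A\<close> and \<open>g = \<gamma> / k\<^sub>x\<close>. Grouped by powers of \<open>Z\<close> and divided by \<open>g\<close>, it becomes
  \<open>c0 + Z c1 + Z\<^sup>2 c2 + Z\<^sup>3 c3\<close>. Each coefficient lies in the open right half plane, and so
  does the sum for \<open>Z > 0\<close>. Without the division this fails: a power \<open>g\<^sup>3\<close> can have an argument
  close to \<open>3 \<pi> / 4\<close>.
\<close>

lemma interface_symbol_nonzero:
  fixes M Z :: real and u g :: complex
  assumes M: "M > 0" and Z: "Z > 0" and u: "norm u < 1" and g: "M * g\<^sup>2 = M + 1 - u" "Re g > 0"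
  shows "(1 + Z) * ((M * g + Z) * (Z + (1 + 2 * M) * M * g\<^sup>2) + (1 + 2 * M) * M\<^sup>2 * g)
    + u * ((1 + 2 * M) * M * g * (2 * M * (g - 1) / (g + 1) - Z * (2 * M + Z))
           + Z * (2 * M - Z\<^sup>2) / (g + 1)) \<noteq> 0" (is "?F \<noteq> 0")
proof -
  have Re_u: "Re u < 1" using u abs_Re_le_cmod[of u] by linarith
  have Mg2: "M * Re (g\<^sup>2) = M + 1 - Re u"
    using arg_cong[OF g(1), of Re] by simp
  then have "M * 1 < M * Re (g\<^sup>2)" using Re_u by linarith
  then have g2: "Re (g\<^sup>2) > 1" using M by (simp only: mult_less_cancel_left_pos)
  then have sq: "(Re g)\<^sup>2 - (Im g)\<^sup>2 > 1" by (simp add: power2_eq_square)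
  then have g1: "Re g > 1" using g(2)
    by (smt (verit, best) one_power2 power_mono zero_le_power2)
  have Im_le: "\<bar>Im g\<bar> < Re g"
    using sq g1 abs_le_square_iff[of "Re g" "Im g"] by linarith
  have g0: "g \<noteq> 0" "g + 1 \<noteq> 0" using g1 by (auto simp: complex_eq_iff)
  have ng: "norm g > 1" "norm (g + 1) > 2"
    using g1 complex_Re_le_cmod[of g] complex_Re_le_cmod[of "g + 1"] by auto
  have Re_scale: "Re (complex_of_real r * z) = r * Re z"
    for r z
    by simp
  define c0 where "c0 = (1 + 2 * M) * M\<^sup>2 * (g\<^sup>2 + 1 + 2 * (u * ((g - 1) / (g + 1))))"
  define c1 where "c1 = (1 + 2 * M) * M\<^sup>2 * (g\<^sup>2 + 1 - 2 * u) + M * (1 + 2 * (u / (g * (g + 1))))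
      + (1 + 2 * M) * M * g"
  define c2 where "c2 = M + 1 / g + (1 + 2 * M) * M * (g - u)"
  define c3 where "c3 = (1 - u / (g + 1)) / g"
  have F: "?F = g * (c0 + Z * c1 + Z\<^sup>2 * c2 + Z ^ 3 * c3)"
    using g0 unfolding c0_def c1_def c2_def c3_def
    by (simp add: divide_simps) algebra
  have small: "Re z > -1" "Re z < 1" if "norm z < 1" for z :: complex
    using that abs_Re_le_cmod[of z] by linarith+
  have "norm (u * ((g - 1) / (g + 1))) < 1"
  proof -
    have "(norm (g - 1))\<^sup>2 \<le> (norm (g + 1))\<^sup>2"
      using g1 unfolding cmod_power2 by (simp add: power2_eq_square algebra_simps)
    then have "norm (g - 1) \<le> norm (g + 1)" by (simp add: power2_le_iff_abs_le)
    then have "norm ((g - 1) / (g + 1)) \<le> 1" using g0 by (simp add: norm_divide)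
    then show ?thesis using u by (smt (verit) mult_left_le norm_ge_zero norm_mult)
  qed
  then have "Re (g\<^sup>2 + 1 + 2 * (u * ((g - 1) / (g + 1)))) > 0"
    using small g2 by (smt (verit) Re_complex_of_real one_complex.simps(1) plus_complex.simps(1) mult_2)
  then have c0: "Re c0 > 0"
    using M by (simp only: c0_def Re_scale) simp
  have "norm (u / (g * (g + 1))) < 1 / 2"
  proof -
    have "norm (g * (g + 1)) > 2" using ng by (smt (verit) norm_mult mult_less_cancel_right1)
    then show ?thesis using u by (simp add: norm_divide divide_simps)
  qed
  then have "Re (1 + 2 * (u / (g * (g + 1)))) > 0"
    using abs_Re_le_cmod[of "u / (g * (g + 1))"]
      Re_scale[of 2 "u / (g * (g + 1))"] by simp
  moreover have "Re (g\<^sup>2 + 1 - 2 * u) > 0" using g2 Re_u by simp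
  moreover have "Re c1 = (1 + 2 * M) * M\<^sup>2 * Re (g\<^sup>2 + 1 - 2 * u)
      + M * Re (1 + 2 * (u / (g * (g + 1)))) + (1 + 2 * M) * M * Re g"
    by (simp only: c1_def plus_complex.simps(1) Re_scale)
  ultimately have c1: "Re c1 > 0"
    using M g1 by (simp only:) (intro add_pos_pos mult_pos_pos; (assumption | simp))
  have "Re (1 / g) > 0" using g1 g0 by (simp add: Re_divide divide_pos_pos sum_power2_gt_zero_iff complex_eq_iff)
  moreover have "Re (g - u) > 0" using g1 Re_u by simp
  moreover have "Re c2 = M + Re (1 / g) + (1 + 2 * M) * M * Re (g - u)"
    by (simp only: c2_def plus_complex.simps(1) Re_scale Re_complex_of_real)
  ultimately have c2: "Re c2 > 0"
    using M by (simp only:) (intro add_pos_pos mult_pos_pos; (assumption | simp))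
  \<comment> \<open>\<open>s\<close> and \<open>1 / g\<close> deviate from the positive axis by angles below \<open>\<pi> / 6\<close> and \<open>\<pi> / 4\<close>.\<close>
  have c3: "Re c3 > 0"
  proof -
    define s where "s = 1 - u / (g + 1)"
    have "norm (u / (g + 1)) < 1 / 2"
      using u ng by (simp add: norm_divide divide_simps)
    then have s: "Re s > 1 / 2" "\<bar>Im s\<bar> < 1 / 2"
      using abs_Re_le_cmod[of "u / (g + 1)"] abs_Im_le_cmod[of "u / (g + 1)"] by (auto simp: s_def)
    have "\<bar>Im s * Im g\<bar> \<le> 1 / 2 * \<bar>Im g\<bar>"
      unfolding abs_mult using s by (intro mult_right_mono) auto
    moreover have "1 / 2 * Re g \<le> Re s * Re g"
      using s g1 by (intro mult_right_mono) auto
    ultimately have "Re s * Re g + Im s * Im g > 0" using Im_le by linarith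
    moreover have "(Re g)\<^sup>2 + (Im g)\<^sup>2 > 0" using g1 by (simp add: add_pos_nonneg)
    ultimately show ?thesis unfolding c3_def s_def[symmetric] by (simp add: Re_divide)
  qed
  have "Re (c0 + Z * c1 + Z\<^sup>2 * c2 + Z ^ 3 * c3) = Re c0 + Z * Re c1 + Z\<^sup>2 * Re c2 + Z ^ 3 * Re c3"
    by (simp only: plus_complex.simps(1) Re_scale)
  also have "\<dots> > 0" using Z c0 c1 c2 c3 by (intro add_pos_pos mult_pos_pos) auto
  finally have "Re (c0 + Z * c1 + Z\<^sup>2 * c2 + Z ^ 3 * c3) > 0" .
  then have "c0 + Z * c1 + Z\<^sup>2 * c2 + Z ^ 3 * c3 \<noteq> 0"
    by (metis less_irrefl zero_complex.simps(1))
  then show ?thesis unfolding F using g0 by simp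
qed

text \<open>
  The three interface conditions in dimensionless form. \<open>\<i> W\<close>, \<open>V\<close> are the amplitudes of
  \<open>exp (-\<gamma> y)\<close> in the two velocity components and \<open>q\<close> is the amplitude of the part driven by the
  pressure. The factor \<open>A - 1\<close> of the determinant comes from \<open>M (g\<^sup>2 - 1) = 1 - 1/A\<close>, which turns
  the remaining factor \<open>g - 1\<close> into \<open>(1 - u) h / M\<close> with \<open>h = 1 / (g + 1)\<close>.
\<close>

lemma interface_system_trivial:
  fixes M Z :: real and A g W V q :: complex
  assumes M: "M > 0" and Z: "Z > 0" and A: "norm A > 1"
    and g: "M * g\<^sup>2 = M + 1 - 1 / A" "Re g > 0"
    and tangential: "M * (V + 2 * q - g * W) - Z * (W - q) = 0"
    and normal: "Z * (V + q) + (1 + 2 * M) * ((M + 1 - 1 / A) * V + M * g * W) = 0"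
    and pressure: "(A - 1) * (1 + Z) * q = 2 * M * (W - q) + Z * M * (V + g * W)"
  shows "W = 0 \<and> V = 0 \<and> q = 0"
proof -
  define m z where "m = complex_of_real M" and "z = complex_of_real Z"
  define u h where "u = 1 / A" and "h = 1 / (g + 1)"
  have nz: "A \<noteq> 0" "A \<noteq> 1" using A by auto
  have "Re (g + 1) > 0" using g by simp
  then have g1: "g + 1 \<noteq> 0" by (metis less_irrefl zero_complex.simps(1))
  have u: "A * u = 1" "norm u < 1" using A nz by (auto simp: u_def norm_divide)
  have h: "(g + 1) * h = 1" using g1 by (simp add: h_def)
  have mg: "m * g\<^sup>2 = m + 1 - u" using g(1) by (simp add: m_def u_def)
  have mgh: "m * (g - 1) = (1 - u) * h" using mg h by algebra
  define F where "F = (1 + z) * ((m * g + z) * (z + (1 + 2 * m) * m * g\<^sup>2) + (1 + 2 * m) * m\<^sup>2 * g)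
    + u * ((1 + 2 * m) * m * g * (2 * m * (g - 1) * h - z * (2 * m + z)) + z * (2 * m - z\<^sup>2) * h)"
  have "F \<noteq> 0"
    using interface_symbol_nonzero[OF M Z u(2), of g] g
    by (simp add: F_def m_def z_def h_def u_def)
  then have "(A - 1) * F \<noteq> 0" using nz by simp
  moreover have "- (m * g + z) * ((z + (1 + 2 * m) * (m * g\<^sup>2)) * (- ((A - 1) * (1 + z) + 2 * m)) - z * m * z)
      - m * ((1 + 2 * m) * m * g * (- ((A - 1) * (1 + z) + 2 * m)) - m * (2 + z * g) * z)
      + (2 * m + z) * ((1 + 2 * m) * m * g * (z * m) - m * (2 + z * g) * (z + (1 + 2 * m) * (m * g\<^sup>2)))
      = (A - 1) * F"
    unfolding F_def using u(1) h mgh mg by algebra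
  ultimately have det: "- (m * g + z) * ((z + (1 + 2 * m) * (m * g\<^sup>2)) * (- ((A - 1) * (1 + z) + 2 * m)) - z * m * z)
      - m * ((1 + 2 * m) * m * g * (- ((A - 1) * (1 + z) + 2 * m)) - m * (2 + z * g) * z)
      + (2 * m + z) * ((1 + 2 * m) * m * g * (z * m) - m * (2 + z * g) * (z + (1 + 2 * m) * (m * g\<^sup>2))) \<noteq> 0"
    by simp
  have row1: "- (m * g + z) * W + m * V + (2 * m + z) * q = 0"
    using tangential unfolding m_def[symmetric] z_def[symmetric] by algebra
  have normal': "z * (V + q) + (1 + 2 * m) * ((m + 1 - u) * V + m * g * W) = 0"
    using normal by (simp add: m_def z_def u_def)
  have row2: "(1 + 2 * m) * m * g * W + (z + (1 + 2 * m) * (m * g\<^sup>2)) * V + z * q = 0"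
    using normal' unfolding mg by algebra
  have pressure': "(A - 1) * (1 + z) * q = 2 * m * (W - q) + z * m * (V + g * W)"
    using pressure by (simp add: m_def z_def)
  have row3: "m * (2 + z * g) * W + z * m * V + - ((A - 1) * (1 + z) + 2 * m) * q = 0"
    using pressure' by algebra
  show ?thesis by (rule linear_system_3_trivial[OF row1 row2 row3 det])
qed

section \<open>Normal modes of the AMP scheme\<close>

locale amp_scheme_positive = amp_scheme +
  assumes positive: "\<rho> > 0" "\<mu> > 0" "rhobar > 0" "cbar > 0" "\<Delta>t > 0" "\<Delta>y > 0" "k\<^sub>x > 0"
begin

lemma zbar_pos: "zbar > 0" and z_f_pos: "z\<^sub>f > 0"
  using positive by (simp_all add: zbar_def z\<^sub>f_def add_pos_pos)

text \<open>
  The fluid traces \<open>vf\<close> and \<open>sf\<close> enter the projected stress and \<open>zbar\<close> times the projected velocity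
  with opposite weights. What is left is the incoming characteristic of the solid itself.
\<close>

lemma projection_is_extrapolation:
  fixes vf sf vs ss :: complex
  shows "projected_stress vf sf vs ss + zbar * projected_velocity vf sf vs ss = ss + zbar * vs"
proof -
  have "complex_of_real (z\<^sub>f + zbar) \<noteq> 0" "complex_of_real z\<^sub>f \<noteq> 0" "complex_of_real zbar \<noteq> 0"
    using zbar_pos z_f_pos by (simp_all only: of_real_eq_0_iff)
  then have nz: "complex_of_real z\<^sub>f + zbar \<noteq> 0" "complex_of_real z\<^sub>f \<noteq> 0" "complex_of_real zbar \<noteq> 0"
    by simp_all
  define i where "i = 1 / (complex_of_real z\<^sub>f + zbar)"
  have i: "(complex_of_real z\<^sub>f + zbar) * i = 1" using nz by (simp add: i_def)
  have velocity: "projected_velocity vf sf vs ss = z\<^sub>f * i * vf + zbar * i * vs + i * (ss - sf)"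
    by (simp add: projected_velocity_def i_def)
  have weights: "1 / (inverse (complex_of_real z\<^sub>f) + inverse zbar) = z\<^sub>f * zbar * i"
    "inverse (complex_of_real z\<^sub>f) / (inverse (complex_of_real z\<^sub>f) + inverse zbar) = zbar * i"
    "inverse (complex_of_real zbar) / (inverse (complex_of_real z\<^sub>f) + inverse zbar) = z\<^sub>f * i"
    using nz by (simp_all add: i_def field_simps)
  have stress: "projected_stress vf sf vs ss = zbar * i * sf + z\<^sub>f * i * ss + z\<^sub>f * zbar * i * (vs - vf)"
    unfolding projected_stress_def using weights by simp
  show ?thesis
    unfolding stress velocity of_real_mult using i by algebra
qed

lemma ghost_values_iff: "ghost_values s \<longleftrightarrow> a1 s 1 = a1 s 0 \<and> a2 s 1 = a2 s 0"
proof -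
  have "(a + b) / 2 + zbar * ((a - b) / (2 * zbar)) = a" for a b :: complex
    using zbar_pos by (simp add: field_simps)
  then show ?thesis
    by (simp only: ghost_values_def projection_is_extrapolation vbar1_def vbar2_def
        sigmabar12_def sigmabar22_def)
qed

lemma solid_vanishes:
  assumes A: "norm A > 1" and CFL: "lambda\<^sub>y cbar \<Delta>t \<Delta>y \<le> 1"
    and adm: "admissible t" and scaled: "agree_scaled A s t"
    and step: "solid_step s t" and ghost: "ghost_values t"
  shows "(\<forall>j\<le>0. b1 t j = 0 \<and> b2 t j = 0 \<and> d t j = 0) \<and> (\<forall>j\<le>1. a1 t j = 0 \<and> a2 t j = 0)"
proof -
  have A0: "A \<noteq> 0" "A \<noteq> 1" using A by auto
  have lam: "lambda\<^sub>y cbar \<Delta>t \<Delta>y > 0" "lambda\<^sub>x cbar \<Delta>t k\<^sub>x \<noteq> 0"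
    using positive by (simp_all add: lambda\<^sub>y_def lambda\<^sub>x_def)
  have level: "b1 t j = A * b1 s j" "b2 t j = A * b2 s j" "d t j = A * d s j" if "j \<le> 0" for j
    using scaled that by (auto simp: agree_scaled_def)
  have level_a: "a1 t j = A * a1 s j" "a2 t j = A * a2 s j" if "j \<le> 1" for j
    using scaled that by (auto simp: agree_scaled_def)
  have eqs: "a1 t j = a1 s j + L\<^sub>y * (a1 s (j + 1) - a1 s j) + \<i> * L\<^sub>x * (d t j - b2 t j)"
     "b1 t j = b1 s j - L\<^sub>y * (b1 s j - b1 s (j - 1)) + \<i> * L\<^sub>x * (a2 t j - d t j)"
     "a2 t j = a2 s j + L\<^sub>y * (a2 s (j + 1) - a2 s j) + \<i> * L\<^sub>x * b1 t j"
     "b2 t j = b2 s j - L\<^sub>y * (b2 s j - b2 s (j - 1)) - \<i> * L\<^sub>x * a1 t j"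
     "d t j = d s j" if "j \<le> 0" for j
    using step that unfolding solid_step_def by blast+
  have d: "d t j = 0" if "j \<le> 0" for j
  proof -
    have "(A - 1) * d s j = 0"
      using eqs(5)[OF that] level(3)[OF that] by (simp add: algebra_simps)
    then show ?thesis using A0 level(3)[OF that] by simp
  qed
  have bdd: "Bfun (a1 t) at_bot" "Bfun (a2 t) at_bot"
    using adm by (simp_all add: admissible_def)
  have ghost': "a1 t 1 = a1 t 0" "a2 t 1 = a2 t 0"
    using ghost by (simp_all add: ghost_values_iff)
  have 1: "(\<forall>j\<le>1. a1 t j = 0) \<and> (\<forall>j\<le>0. b2 t j = 0)"
  proof (rule solid_mode_trivial[OF lam(1) CFL lam(2) A _ _ bdd(1) ghost'(1)])
    fix j :: int assume j: "j \<le> 0"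
    show "A * a1 t j = a1 t j + L\<^sub>y * (a1 t (j + 1) - a1 t j) - \<i> * L\<^sub>x * (A * b2 t j)"
      using eqs(1)[OF j] level_a(1)[of j] level_a(1)[of "j + 1"] d[OF j] j by simp algebra
    show "A * b2 t j = b2 t j - L\<^sub>y * (b2 t j - b2 t (j - 1)) - \<i> * L\<^sub>x * (A * a1 t j)"
      using eqs(4)[OF j] level(2)[of j] level(2)[of "j - 1"] j by simp algebra
  qed
  \<comment> \<open>The second pair of characteristics satisfies the same system after the sign change \<open>b1 \<mapsto> - b1\<close>.\<close>
  have 2: "(\<forall>j\<le>1. a2 t j = 0) \<and> (\<forall>j\<le>0. - b1 t j = 0)"
  proof (rule solid_mode_trivial[OF lam(1) CFL lam(2) A _ _ bdd(2) ghost'(2)])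
    fix j :: int assume j: "j \<le> 0"
    show "A * a2 t j = a2 t j + L\<^sub>y * (a2 t (j + 1) - a2 t j) - \<i> * L\<^sub>x * (A * - b1 t j)"
      using eqs(3)[OF j] level_a(2)[of j] level_a(2)[of "j + 1"] j by simp algebra
    show "A * - b1 t j = - b1 t j - L\<^sub>y * (- b1 t j - - b1 t (j - 1)) - \<i> * L\<^sub>x * (A * a2 t j)"
      using eqs(2)[OF j] level(1)[of j] level(1)[of "j - 1"] d[OF j] j by simp algebra
  qed
  show ?thesis using 1 2 d by auto
qed

text \<open>
  The fluid next to a solid at rest. The pressure \<open>p(0) exp (-k\<^sub>x y)\<close> drives the part
  \<open>(- \<i> q, q) exp (-k\<^sub>x y)\<close> of the velocity, with \<open>q\<close> chosen so that the forcing takes the form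
  required by \<open>bounded_forced_solution\<close>. The quotient \<open>\<rho> / (k\<^sub>x \<Delta>t)\<close> is the natural unit
  of impedance: it turns \<open>\<mu> k\<^sub>x\<close>, \<open>zbar\<close> and \<open>z\<^sub>f\<close> into \<open>M\<close>, \<open>Z\<close> and \<open>1 + 2 M\<close>.
\<close>

lemma fluid_vanishes:
  assumes A: "norm A > 1" and adm: "admissible t" and scaled: "agree_scaled A s t"
    and step: "fluid_step s t" and tangential: "interface_tangential t"
    and normal: "interface_normal s t" and pressure: "interface_pressure s t"
    and solid: "vbar1 t = 0" "vbar2 t = 0" "vbar2 s = 0" "sigmabar12 t = 0" "sigmabar22 t = 0"
    and y: "y \<ge> 0"
  shows "v1 t y = 0 \<and> v2 t y = 0 \<and> p t y = 0"
proof -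
  define M Z where "M = \<nu> * \<Delta>t * k\<^sub>x\<^sup>2" and "Z = zbar * k\<^sub>x * \<Delta>t / \<rho>"
  have MZ: "M > 0" "Z > 0"
    using positive zbar_pos by (simp_all add: M_def Z_def \<nu>_def)
  have A0: "A \<noteq> 0" "A \<noteq> 1" using A by auto
  define g where "g = csqrt (1 + (1 - 1 / A) / M)"
  have Mg: "M * g\<^sup>2 = M + 1 - 1 / A"
    using MZ by (simp add: g_def field_simps)
  have "norm (1 / A) < 1" using A A0 by (simp add: norm_divide divide_less_eq)
  then have "Re (1 / A) < 1" using abs_Re_le_cmod[of "1 / A"] by linarith
  then have "Re (1 + (1 - 1 / A) / M) > 0"
    using MZ by (simp add: add_pos_pos)
  then have g_pos: "Re g > 0"
    unfolding g_def by (subst csqrt.sel(1)) (smt (verit) real_sqrt_gt_0_iff complex_Re_le_cmod divide_pos_pos)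
  define \<gamma> where "\<gamma> = k\<^sub>x * g"
  have \<gamma>_pos: "Re \<gamma> > 0" using g_pos positive by (simp add: \<gamma>_def)
  have reg: "regular (v1 t)" "regular (v2 t)" "regular (p t)"
    and bdd: "Bfun (v1 t) at_top" "Bfun (v2 t) at_top" "Bfun (p t) at_top"
    using adm by (simp_all add: admissible_def)
  have level: "v1 s y = v1 t y / A" "v2 s y = v2 t y / A" "p s y = p t y / A" if "y \<ge> 0" for y
    using scaled that A0 by (auto simp: agree_scaled_def)
  have Dp_s: "D\<^sub>y (p s) y = 1 / A * D\<^sub>y (p t) y" if "y \<ge> 0" for y
    by (rule D_y_scaled[OF reg(3)]) (use level that in simp_all)
  have eqs: "v1 t y = v1 s y - \<i> * k\<^sub>x * \<Delta>t / \<rho> * p s y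
                + \<nu> * \<Delta>t * (- (k\<^sub>x\<^sup>2 * v1 t y) + D\<^sub>y (D\<^sub>y (v1 t)) y)"
     "v2 t y = v2 s y - \<Delta>t / \<rho> * D\<^sub>y (p s) y
                + \<nu> * \<Delta>t * (- (k\<^sub>x\<^sup>2 * v2 t y) + D\<^sub>y (D\<^sub>y (v2 t)) y)"
     "- (k\<^sub>x\<^sup>2 * p t y) + D\<^sub>y (D\<^sub>y (p t)) y = 0" if "y > 0" for y
    using step that unfolding fluid_step_def by blast+
  define q where "q = k\<^sub>x * \<Delta>t / \<rho> * p t 0 / (A - 1)"
  have p0: "p t 0 = \<rho> / (k\<^sub>x * \<Delta>t) * ((A - 1) * q)"
    using positive A0 by (simp add: q_def)
  \<comment> \<open>The vanishing second term fits the shape that \<open>D_y_two_exponentials\<close> differentiates.\<close>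
  have p_eq: "p t y = p t 0 * exp (- k\<^sub>x * complex_of_real y) + 0 * exp (0 * complex_of_real y)"
    if "y \<ge> 0" for y
  proof -
    have "p t y = (p t 0 + 0) * exp (- complex_of_real k\<^sub>x * y) - 0 * exp (- k\<^sub>x * complex_of_real y)"
      by (rule bounded_forced_solution[OF reg(3) bdd(3)])
        (use eqs(3) that positive in \<open>simp_all add: algebra_simps\<close>)
    then show ?thesis by simp
  qed
  have Dp: "D\<^sub>y (p t) y = - k\<^sub>x * p t 0 * exp (- k\<^sub>x * complex_of_real y)" if "y \<ge> 0" for y
    using D_y_two_exponentials[OF p_eq that] by simp
  have nt: "complex_of_real (\<nu> * \<Delta>t) \<noteq> 0" using positive by (simp add: \<nu>_def)
  have gam: "\<nu> * \<Delta>t * (\<gamma>\<^sup>2 - k\<^sub>x\<^sup>2) = 1 - 1 / A"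
    using Mg by (simp add: \<gamma>_def M_def algebra_simps power_mult_distrib)
  have v1_eq: "v1 t y = (v1 t 0 + \<i> * q) * exp (- \<gamma> * y) - \<i> * q * exp (- k\<^sub>x * complex_of_real y)"
    if "y \<ge> 0" for y
  proof (rule bounded_forced_solution[OF reg(1) bdd(1) \<gamma>_pos _ _ that])
    fix y :: real assume y: "y > 0"
    let ?e = "exp (- k\<^sub>x * complex_of_real y)"
    have "\<nu> * \<Delta>t * D\<^sub>y (D\<^sub>y (v1 t)) y = (1 - 1 / A + \<nu> * \<Delta>t * k\<^sub>x\<^sup>2) * v1 t y + (1 - 1 / A) * (\<i> * q * ?e)"
    proof -
      have ps: "p s y = \<rho> / (k\<^sub>x * \<Delta>t) * ((A - 1) * q) * ?e / A"
        using level(3)[of y] p_eq[of y] y by (simp add: p0)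
      have forcing: "\<i> * k\<^sub>x * \<Delta>t / \<rho> * p s y = (1 - 1 / A) * (\<i> * q * ?e)"
        unfolding ps using positive A0 by (simp add: field_simps)
      then show ?thesis
        using eqs(1)[OF y] unfolding forcing level(1)[OF less_imp_le[OF y]]
        by (simp add: algebra_simps)
    qed
    also have "\<dots> = \<nu> * \<Delta>t * (\<gamma>\<^sup>2 * v1 t y + (\<gamma>\<^sup>2 - k\<^sub>x\<^sup>2) * (\<i> * q) * ?e)"
      unfolding gam[symmetric] by (simp add: algebra_simps)
    finally show "D\<^sub>y (D\<^sub>y (v1 t)) y = \<gamma>\<^sup>2 * v1 t y + (\<gamma>\<^sup>2 - k\<^sub>x\<^sup>2) * (\<i> * q) * ?e"
      using nt by simp
  qed (use positive in simp)
  have v2_eq: "v2 t y = (v2 t 0 + - q) * exp (- \<gamma> * y) - - q * exp (- k\<^sub>x * complex_of_real y)"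
    if "y \<ge> 0" for y
  proof (rule bounded_forced_solution[OF reg(2) bdd(2) \<gamma>_pos _ _ that])
    fix y :: real assume y: "y > 0"
    let ?e = "exp (- k\<^sub>x * complex_of_real y)"
    have "\<nu> * \<Delta>t * D\<^sub>y (D\<^sub>y (v2 t)) y = (1 - 1 / A + \<nu> * \<Delta>t * k\<^sub>x\<^sup>2) * v2 t y + (1 - 1 / A) * (- q * ?e)"
    proof -
      have Dps: "D\<^sub>y (p s) y = - k\<^sub>x * (\<rho> / (k\<^sub>x * \<Delta>t) * ((A - 1) * q)) * ?e / A"
        using Dp_s[of y] Dp[of y] y by (simp add: p0)
      have forcing: "\<Delta>t / \<rho> * D\<^sub>y (p s) y = (1 - 1 / A) * (- q * ?e)"
        unfolding Dps using positive A0 by (simp add: field_simps)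
      then show ?thesis
        using eqs(2)[OF y] unfolding forcing level(2)[OF less_imp_le[OF y]]
        by (simp add: algebra_simps)
    qed
    also have "\<dots> = \<nu> * \<Delta>t * (\<gamma>\<^sup>2 * v2 t y + (\<gamma>\<^sup>2 - k\<^sub>x\<^sup>2) * (- q) * ?e)"
      unfolding gam[symmetric] by (simp add: algebra_simps)
    finally show "D\<^sub>y (D\<^sub>y (v2 t)) y = \<gamma>\<^sup>2 * v2 t y + (\<gamma>\<^sup>2 - k\<^sub>x\<^sup>2) * (- q) * ?e"
      using nt by simp
  qed (use positive in simp)
  \<comment> \<open>The factor \<open>- \<i>\<close> makes all coefficients of the linear system free of \<open>\<i>\<close>.\<close>
  define W V where "W = - \<i> * (v1 t 0 + \<i> * q)" and "V = v2 t 0 - q"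
  have trace: "v1 t 0 = \<i> * (W - q)" "v2 t 0 = V + q"
    by (simp_all add: W_def V_def algebra_simps)
  have iW: "v1 t 0 + \<i> * q = \<i> * W" by (simp add: W_def algebra_simps)
  have Dv1: "D\<^sub>y (v1 t) 0 = \<i> * k\<^sub>x * (q - g * W)"
  proof -
    have "v1 t y = \<i> * W * exp (- \<gamma> * complex_of_real y) + - \<i> * q * exp (- k\<^sub>x * complex_of_real y)"
      if "y \<ge> 0" for y
      using v1_eq[OF that] by (simp add: iW)
    from D_y_two_exponentials[OF this, of 0] show ?thesis
      by (simp add: \<gamma>_def algebra_simps)
  qed
  have Dp0: "D\<^sub>y (p t) 0 = - (\<rho> / \<Delta>t * ((A - 1) * q))"
    using Dp[of 0] positive by (simp add: p0)
  have "W = 0 \<and> V = 0 \<and> q = 0"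
  proof (rule interface_system_trivial[OF MZ A Mg g_pos])
    define \<sigma> where "\<sigma> = complex_of_real (k\<^sub>x * \<Delta>t / \<rho>)"
    have Mc: "\<sigma> * \<mu> * k\<^sub>x = M" and Zc: "\<sigma> * zbar = Z" and zf: "\<sigma> * z\<^sub>f = 1 + 2 * M"
      and Mk: "\<nu> * \<Delta>t * k\<^sub>x\<^sup>2 = complex_of_real M"
      using positive by (simp_all add: \<sigma>_def M_def Z_def z\<^sub>f_def \<nu>_def field_simps power2_eq_square)
    have "\<mu> * k\<^sub>x * (V + 2 * q - g * W) - zbar * (W - q) = 0"
    proof -
      have "\<i> * (\<mu> * k\<^sub>x * (V + 2 * q - g * W) - zbar * (W - q)) = 0"
        using tangential unfolding interface_tangential_def solid trace Dv1
        by (simp add: algebra_simps)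
      then show ?thesis by simp
    qed
    then show "M * (V + 2 * q - g * W) - Z * (W - q) = 0"
      using Mc Zc unfolding of_real_add of_real_mult of_real_1 of_real_numeral by algebra
    \<comment> \<open>The viscous terms of the normal and of the pressure condition are the same.\<close>
    have visc: "\<nu> * \<Delta>t * (k\<^sub>x\<^sup>2 * v2 t 0 + \<i> * k\<^sub>x * D\<^sub>y (v1 t) 0) = M * (V + g * W)"
      unfolding trace Dv1 Mk[symmetric] by (simp add: algebra_simps power2_eq_square)
    have "complex_of_real (z\<^sub>f + zbar) \<noteq> 0" using zbar_pos z_f_pos by (simp only: of_real_eq_0_iff)
    then have nz: "complex_of_real z\<^sub>f + zbar \<noteq> 0" by simp
    have Dps0: "\<Delta>t / \<rho> * D\<^sub>y (p s) 0 = - ((A - 1) * q / A)"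
      using positive Dp_s[of 0] by (simp add: Dp0)
    have "v2 s 0 - \<Delta>t / \<rho> * D\<^sub>y (p s) 0 = V / A + q"
      unfolding Dps0 level(2)[OF order.refl] trace using A0 by (simp add: field_simps)
    then have "V + q = z\<^sub>f / (z\<^sub>f + zbar) * (V / A + q - M * (V + g * W))"
      using normal unfolding interface_normal_def visc unfolding solid trace(2) by simp
    then have "(z\<^sub>f + zbar) * (V + q) = z\<^sub>f * (V / A + q - M * (V + g * W))"
      using nz by (simp add: field_simps)
    then have "zbar * (V + q) + z\<^sub>f * ((M + 1 - 1 / A) * V + M * g * W) = 0"
      by (simp add: algebra_simps)
    then show "Z * (V + q) + (1 + 2 * M) * ((M + 1 - 1 / A) * V + M * g * W) = 0"
      using Zc zf unfolding of_real_add of_real_mult of_real_1 of_real_numeral by algebra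
    have "zbar * \<Delta>t * ((vbar2 t - vbar2 s) / \<Delta>t + \<nu> * (k\<^sub>x\<^sup>2 * v2 t 0 + \<i> * k\<^sub>x * D\<^sub>y (v1 t) 0))
        = zbar * (M * (V + g * W))"
      unfolding visc[symmetric] solid by (simp add: algebra_simps)
    then have "- p t 0 + zbar * (\<Delta>t / \<rho> * D\<^sub>y (p t) 0) = 2 * (\<mu> * k\<^sub>x) * (\<i> * v1 t 0) - zbar * (M * (V + g * W))"
      using pressure unfolding interface_pressure_def by (simp add: solid mult_ac)
    moreover have "\<Delta>t / \<rho> * D\<^sub>y (p t) 0 = - ((A - 1) * q)"
      using positive by (simp add: Dp0)
    moreover have "\<sigma> * p t 0 = (A - 1) * q"
      using positive by (simp add: p0 \<sigma>_def)
    moreover have "\<i> * v1 t 0 = - (W - q)" by (simp add: trace)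
    ultimately show "(A - 1) * (1 + Z) * q = 2 * M * (W - q) + Z * M * (V + g * W)"
      using Mc Zc unfolding of_real_add of_real_mult of_real_1 of_real_numeral by algebra
  qed
  then show ?thesis
    using v1_eq[OF y] v2_eq[OF y] p_eq[OF y] p0 by (simp add: trace)
qed

text \<open>
  Two consecutive time levels determine a mode; the later one is examined because the interface
  and ghost conditions are imposed only after a step. The pressure condition also involves the
  solid velocity of the earlier level.
\<close>

lemma weakly_stable_if_lambda_y_le_1:
  assumes "lambda\<^sub>y cbar \<Delta>t \<Delta>y \<le> 1"
  shows weakly_stable
  unfolding weakly_stable_def
proof safe
  fix A U assume mode: "normal_mode A U" and nontriv: "nontrivial U" and A: "norm A > 1"
  obtain r where r: "\<And>n. agree_scaled (A ^ n) r (U n)" and sol: "amp_solution U"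
    using mode by (auto simp: normal_mode_def)
  let ?s = "U 0" and ?t = "U 1"
  have A0: "A \<noteq> 0" using A by auto
  have scaled: "agree_scaled A ?s ?t"
    using r[of 0] r[of 1] by (simp add: agree_scaled_def)
  have adm: "admissible ?t" and eqs: "solid_step ?s ?t" "fluid_step ?s ?t" "interface_tangential ?t"
    "interface_normal ?s ?t" "interface_pressure ?s ?t" "ghost_values ?t"
    using sol by (auto simp: amp_solution_def)
  have solid: "(\<forall>j\<le>0. b1 ?t j = 0 \<and> b2 ?t j = 0 \<and> d ?t j = 0) \<and> (\<forall>j\<le>1. a1 ?t j = 0 \<and> a2 ?t j = 0)"
    by (rule solid_vanishes[OF A assms adm scaled eqs(1,6)])
  moreover have "a2 ?s 0 = 0" "b2 ?s 0 = 0"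
    using scaled solid A0 by (auto simp: agree_scaled_def)
  ultimately have "v1 ?t y = 0 \<and> v2 ?t y = 0 \<and> p ?t y = 0" if "y \<ge> 0" for y
    by (intro fluid_vanishes[OF A adm scaled eqs(2-5) _ _ _ _ _ that])
       (simp_all add: vbar1_def vbar2_def sigmabar12_def sigmabar22_def)
  then have "vanishes ?t" using solid by (simp add: vanishes_def)
  then have "vanishes r" using r[of 1] A0 by (auto simp: vanishes_def agree_scaled_def)
  then have "vanishes (U n)" for n using r[of n] by (simp add: vanishes_def agree_scaled_def)
  with nontriv show False by (simp add: nontrivial_def)
qed

end

section \<open>The stability theorem\<close>

lemma CFL_iff_time_step_bound:
  fixes cbar \<Delta>t \<Delta>y k\<^sub>x :: real
  assumes "cbar > 0" "\<Delta>t > 0" "\<Delta>y > 0"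
  shows "(lambda\<^sub>x cbar \<Delta>t k\<^sub>x)\<^sup>2 + (lambda\<^sub>y cbar \<Delta>t \<Delta>y)\<^sup>2 \<le> 1 \<longleftrightarrow>
    \<Delta>t \<le> 1 / cbar * (1 / \<Delta>y\<^sup>2 + k\<^sub>x\<^sup>2) powr (- 1 / 2)"
proof -
  define S where "S = 1 / \<Delta>y\<^sup>2 + k\<^sub>x\<^sup>2"
  have S: "S > 0" using assms by (simp add: S_def add_pos_nonneg)
  have powr: "S powr (- 1 / 2) = 1 / sqrt S"
    using S by (simp add: powr_minus powr_half_sqrt field_simps)
  have "(lambda\<^sub>x cbar \<Delta>t k\<^sub>x)\<^sup>2 + (lambda\<^sub>y cbar \<Delta>t \<Delta>y)\<^sup>2 = (cbar * \<Delta>t * sqrt S)\<^sup>2"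
    using S by (simp add: S_def lambda\<^sub>x_def lambda\<^sub>y_def power_mult_distrib power_divide algebra_simps)
  also have "\<dots> \<le> 1 \<longleftrightarrow> cbar * \<Delta>t * sqrt S \<le> 1"
    using assms S by (simp add: abs_square_le_1 abs_mult)
  also have "\<dots> \<longleftrightarrow> \<Delta>t \<le> 1 / cbar * (1 / sqrt S)"
    using assms S by (simp add: field_simps)
  finally show ?thesis by (simp only: powr flip: S_def)
qed

theorem mainTheorem1:
  shows
    "(\<forall>\<rho> \<mu> rhobar cbar \<Delta>t \<Delta>y k\<^sub>x :: real.
        \<rho> > 0 \<and> \<mu> > 0 \<and> rhobar > 0 \<and> cbar > 0 \<and> \<Delta>t > 0 \<and> \<Delta>y > 0 \<and> k\<^sub>x > 0 \<longrightarrow>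
          ((lambda\<^sub>x cbar \<Delta>t k\<^sub>x)\<^sup>2 + (lambda\<^sub>y cbar \<Delta>t \<Delta>y)\<^sup>2 \<le> 1 \<longrightarrow>
             amp_scheme.weakly_stable \<rho> \<mu> rhobar cbar \<Delta>t \<Delta>y k\<^sub>x) \<and>
          ((lambda\<^sub>x cbar \<Delta>t k\<^sub>x)\<^sup>2 + (lambda\<^sub>y cbar \<Delta>t \<Delta>y)\<^sup>2 \<le> 1 \<longleftrightarrow>
             \<Delta>t \<le> 1 / cbar * (1 / \<Delta>y\<^sup>2 + k\<^sub>x\<^sup>2) powr (- 1 / 2)) \<and>
          (\<Delta>t \<le> 1 / cbar * (1 / \<Delta>y\<^sup>2 + k\<^sub>x\<^sup>2) powr (- 1 / 2) \<longrightarrow>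
             amp_scheme.weakly_stable \<rho> \<mu> rhobar cbar \<Delta>t \<Delta>y k\<^sub>x)) \<and>
     (\<exists>\<rho> \<mu> rhobar cbar \<Delta>t \<Delta>y k\<^sub>x :: real.
        \<rho> > 0 \<and> \<mu> > 0 \<and> rhobar > 0 \<and> cbar > 0 \<and> \<Delta>t > 0 \<and> \<Delta>y > 0 \<and> k\<^sub>x > 0 \<and>
        \<not> ((lambda\<^sub>x cbar \<Delta>t k\<^sub>x)\<^sup>2 + (lambda\<^sub>y cbar \<Delta>t \<Delta>y)\<^sup>2 \<le> 1) \<and>
        amp_scheme.weakly_stable \<rho> \<mu> rhobar cbar \<Delta>t \<Delta>y k\<^sub>x)"
proof (intro conjI allI impI)
  fix \<rho> \<mu> rhobar cbar \<Delta>t \<Delta>y k\<^sub>x :: real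
  assume pos: "\<rho> > 0 \<and> \<mu> > 0 \<and> rhobar > 0 \<and> cbar > 0 \<and> \<Delta>t > 0 \<and> \<Delta>y > 0 \<and> k\<^sub>x > 0"
  then interpret amp_scheme_positive \<rho> \<mu> rhobar cbar \<Delta>t \<Delta>y k\<^sub>x
    by unfold_locales auto
  show iff: "(lambda\<^sub>x cbar \<Delta>t k\<^sub>x)\<^sup>2 + (lambda\<^sub>y cbar \<Delta>t \<Delta>y)\<^sup>2 \<le> 1 \<longleftrightarrow>
             \<Delta>t \<le> 1 / cbar * (1 / \<Delta>y\<^sup>2 + k\<^sub>x\<^sup>2) powr (- 1 / 2)"
    using pos by (intro CFL_iff_time_step_bound) auto
  show stable: weakly_stable if "(lambda\<^sub>x cbar \<Delta>t k\<^sub>x)\<^sup>2 + (lambda\<^sub>y cbar \<Delta>t \<Delta>y)\<^sup>2 \<le> 1"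
  proof (rule weakly_stable_if_lambda_y_le_1)
    have "(lambda\<^sub>y cbar \<Delta>t \<Delta>y)\<^sup>2 \<le> 1"
      using that zero_le_power2[of "lambda\<^sub>x cbar \<Delta>t k\<^sub>x"] by linarith
    then show "lambda\<^sub>y cbar \<Delta>t \<Delta>y \<le> 1" by (simp add: abs_square_le_1)
  qed
  show weakly_stable if "\<Delta>t \<le> 1 / cbar * (1 / \<Delta>y\<^sup>2 + k\<^sub>x\<^sup>2) powr (- 1 / 2)"
    using that iff stable by blast
next
  \<comment> \<open>With all parameters equal to one, \<open>\<lambda>\<^sub>x = \<lambda>\<^sub>y = 1\<close>.\<close>
  interpret amp_scheme_positive 1 1 1 1 1 1 1 by unfold_locales auto
  have "lambda\<^sub>y 1 1 1 \<le> 1" by (simp add: lambda\<^sub>y_def)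
  then have "weakly_stable" by (rule weakly_stable_if_lambda_y_le_1)
  moreover have "\<not> ((lambda\<^sub>x 1 1 1)\<^sup>2 + (lambda\<^sub>y 1 1 1)\<^sup>2 \<le> 1)"
    by (simp add: lambda\<^sub>x_def lambda\<^sub>y_def)
  ultimately show "\<exists>\<rho> \<mu> rhobar cbar \<Delta>t \<Delta>y k\<^sub>x :: real.
        \<rho> > 0 \<and> \<mu> > 0 \<and> rhobar > 0 \<and> cbar > 0 \<and> \<Delta>t > 0 \<and> \<Delta>y > 0 \<and> k\<^sub>x > 0 \<and>
        \<not> ((lambda\<^sub>x cbar \<Delta>t k\<^sub>x)\<^sup>2 + (lambda\<^sub>y cbar \<Delta>t \<Delta>y)\<^sup>2 \<le> 1) \<and>
        amp_scheme.weakly_stable \<rho> \<mu> rhobar cbar \<Delta>t \<Delta>y k\<^sub>x"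
    by (intro exI[of _ 1]) simp
qed

end
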